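(* Let $\psi:\mathbb C\to\mathbb C$ be the random entire function $\psi(z)=\sum_{k=0}^\infty \zeta_k z^k/\sqrt{k!}$, where $\zeta_0,\zeta_1,\dots$ are independent standard complex Gaussian random variables, and let $\sigma\in(0,\infty)$ be the absolute constant such that for every compactly supported $C^2$-function $g:\mathbb C\to\mathbb R$, $$\lim_{r\to\infty,\ \lambda\to0,\ \lambda\log^2 r\to0}\ \frac1{r^2\lambda^2}\ln\mathbb E\exp\bigg(\lambda r^2\Big(\sum_{z:\psi(z)=0}g\Big(\frac zr\Big)-\frac{r^2}{\pi}\int g\,dm\Big)\bigg)=\frac{\sigma^2}2\int|\Delta g|^2\,dm$$ (such a constant exists). Let $h:\mathbb C\to\mathbb R$ be a compactly supported $C^2$-function. Then $$\lim_{r\to\infty,\ c\to\infty,\ (c\log^2r)/r\to0}\ \frac1{c^2}\ln\mathbb P\bigg(\sum_{z:\psi(z)=0}h\Big(\frac zr\Big)-\frac{r^2}\pi\int h\,dm\ \ge\ \frac{c\sigma}{r}\sqrt{\int|\Delta h|^2\,dm}\bigg)=-\frac12 .$$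
   Context: A standard complex Gaussian random variable has density $z\mapsto\pi^{-1}e^{-|z|^2}$ with respect to Lebesgue measure on $\mathbb C$. $m$ is Lebesgue measure on $\mathbb C$; $C^2$ and the Laplacian $\Delta$ are understood under the identification $\mathbb C=\mathbb R^2$. The first limit is a joint limit: for every $\varepsilon>0$ there exist $R$ and $\delta>0$ such that the expression is within $\varepsilon$ of the right-hand side for all $r\ge R$ and all $\lambda\neq0$ with $|\lambda|\le\delta$ and $|\lambda|\log^2r\le\delta$. The second limit is likewise a joint limit, i.e. it holds along all sequences $(r_n,c_n)$ with $r_n\to\infty$, $c_n\to\infty$, $(c_n\log^2r_n)/r_n\to0$.
   Formalization: The function h is assumed not identically zero; for h = 0 the event is 0 ≥ 0, which has probability 1, so the claimed limit −1/2 fails. *)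

theory Defs
  imports "HOL-Probability.Probability"
begin

text \<open>
  The two-parameter limits are limits along filters on pairs; the two lemmas below state what
  ``eventually'' means for them.
\<close>

definition small_lambda_filter :: "(real \<times> real) filter" where
  "small_lambda_filter =
     inf (at_top \<times>\<^sub>F at 0) (filtercomap (\<lambda>(r, l). l * (ln r)\<^sup>2) (nhds 0))"

definition moderate_filter :: "(real \<times> real) filter" where
  "moderate_filter =
     inf (at_top \<times>\<^sub>F at_top) (filtercomap (\<lambda>(r, c). c * (ln r)\<^sup>2 / r) (nhds 0))"

lemma eventually_small_lambda_filter:
  "eventually P small_lambda_filter \<longleftrightarrow>
     (\<exists>R \<delta>. 0 < \<delta> \<and> (\<forall>r l. R \<le> r \<and> l \<noteq> 0 \<and> \<bar>l\<bar> \<le> \<delta> \<and> \<bar>l\<bar> * (ln r)\<^sup>2 \<le> \<delta> \<longrightarrow> P (r, l)))"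
  (is "?L \<longleftrightarrow> ?R")
proof
  assume ?L
  then obtain Q S where Q: "eventually Q (at_top \<times>\<^sub>F at 0)"
    and S: "eventually S (filtercomap (\<lambda>(r, l). l * (ln r)\<^sup>2) (nhds (0::real)))"
    and P: "\<And>x. Q x \<Longrightarrow> S x \<Longrightarrow> P x"
    unfolding small_lambda_filter_def eventually_inf by blast
  from Q obtain Qr Ql where "eventually Qr at_top" "eventually Ql (at 0)"
    and QQ: "\<And>r l. Qr r \<Longrightarrow> Ql l \<Longrightarrow> Q (r, l)"
    unfolding eventually_prod_filter by blast
  then obtain R d where R: "\<And>r. R \<le> r \<Longrightarrow> Qr r"
    and d: "0 < d" "\<And>l. l \<noteq> 0 \<Longrightarrow> \<bar>l\<bar> < d \<Longrightarrow> Ql l"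
    unfolding eventually_at_top_linorder eventually_at dist_real_def by (metis UNIV_I diff_0_right)
  from S obtain e where e: "0 < e" "\<And>r l. \<bar>l * (ln r)\<^sup>2\<bar> < e \<Longrightarrow> S (r, l)"
    unfolding eventually_filtercomap eventually_nhds_metric by (fastforce simp: dist_real_def)
  have "P (r, l)" if "R \<le> r" "l \<noteq> 0" "\<bar>l\<bar> \<le> min d e / 2" "\<bar>l\<bar> * (ln r)\<^sup>2 \<le> min d e / 2" for r l
  proof (rule P)
    have "\<bar>l\<bar> < d" "\<bar>l * (ln r)\<^sup>2\<bar> < e"
      using that d(1) e(1) by (auto simp: abs_mult)
    then show "Q (r, l)" "S (r, l)"
      using QQ R d e that by auto
  qed
  then show ?R
    using d(1) e(1) by (intro exI[of _ R] exI[of _ "min d e / 2"]) auto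
next
  assume ?R
  then obtain R d where d: "0 < d"
    and P: "\<And>r l. R \<le> r \<Longrightarrow> l \<noteq> 0 \<Longrightarrow> \<bar>l\<bar> \<le> d \<Longrightarrow> \<bar>l\<bar> * (ln r)\<^sup>2 \<le> d \<Longrightarrow> P (r, l)"
    by blast
  have 1: "eventually (\<lambda>(r, l). R \<le> r \<and> l \<noteq> 0 \<and> \<bar>l\<bar> \<le> d) (at_top \<times>\<^sub>F at (0::real))"
    unfolding eventually_prod_filter
  proof (intro exI conjI)
    show "eventually (\<lambda>r. R \<le> r) at_top" by (rule eventually_ge_at_top)
    show "eventually (\<lambda>l. l \<noteq> 0 \<and> \<bar>l\<bar> \<le> d) (at (0::real))"
      unfolding eventually_at using d by (auto simp: dist_real_def)
  qed auto
  have 2: "eventually (\<lambda>(r, l). \<bar>l\<bar> * (ln r)\<^sup>2 \<le> d)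
             (filtercomap (\<lambda>(r, l). l * (ln r)\<^sup>2) (nhds (0::real)))"
    unfolding eventually_filtercomap
  proof (intro exI conjI)
    show "eventually (\<lambda>x. \<bar>x\<bar> \<le> d) (nhds (0::real))"
      unfolding eventually_nhds_metric using d by (auto simp: dist_real_def)
  qed (auto simp: abs_mult)
  show ?L
    unfolding small_lambda_filter_def eventually_inf
    using 1 2 P by (intro exI conjI) auto
qed

lemma eventually_moderate_filter:
  "eventually P moderate_filter \<longleftrightarrow>
     (\<exists>R C \<delta>. 0 < \<delta> \<and> (\<forall>r c. R \<le> r \<and> C \<le> c \<and> \<bar>c * (ln r)\<^sup>2 / r\<bar> \<le> \<delta> \<longrightarrow> P (r, c)))"
  (is "?L \<longleftrightarrow> ?R")
proof
  assume ?L
  then obtain Q S where Q: "eventually Q (at_top \<times>\<^sub>F at_top)"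
    and S: "eventually S (filtercomap (\<lambda>(r, c). c * (ln r)\<^sup>2 / r) (nhds (0::real)))"
    and P: "\<And>x. Q x \<Longrightarrow> S x \<Longrightarrow> P x"
    unfolding moderate_filter_def eventually_inf by blast
  from Q obtain Qr Qc where "eventually Qr at_top" "eventually Qc at_top"
    and QQ: "\<And>r c. Qr r \<Longrightarrow> Qc c \<Longrightarrow> Q (r, c)"
    unfolding eventually_prod_filter by blast
  then obtain R C where RC: "\<And>r. R \<le> r \<Longrightarrow> Qr r" "\<And>c. C \<le> c \<Longrightarrow> Qc c"
    unfolding eventually_at_top_linorder by blast
  from S obtain e where e: "0 < e" "\<And>r c. \<bar>c * (ln r)\<^sup>2 / r\<bar> < e \<Longrightarrow> S (r, c)"
    unfolding eventually_filtercomap eventually_nhds_metric by (fastforce simp: dist_real_def)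
  have "P (r, c)" if "R \<le> r" "C \<le> c" "\<bar>c * (ln r)\<^sup>2 / r\<bar> \<le> e / 2" for r c
  proof (rule P)
    show "Q (r, c)" using that QQ RC by blast
    have "\<bar>c * (ln r)\<^sup>2 / r\<bar> < e" using that(3) by (rule le_less_trans) (use e(1) in simp)
    then show "S (r, c)" by (rule e(2))
  qed
  then show ?R
    using e(1) by (intro exI[of _ R] exI[of _ C] exI[of _ "e / 2"]) auto
next
  assume ?R
  then obtain R C d where d: "0 < d"
    and P: "\<And>r c. R \<le> r \<Longrightarrow> C \<le> c \<Longrightarrow> \<bar>c * (ln r)\<^sup>2 / r\<bar> \<le> d \<Longrightarrow> P (r, c)"
    by blast
  have 1: "eventually (\<lambda>(r, c). R \<le> r \<and> C \<le> c) (at_top \<times>\<^sub>F at_top)"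
    unfolding eventually_prod_filter
    by (intro exI[of _ "\<lambda>r. R \<le> r"] exI[of _ "\<lambda>c. C \<le> c"]) (auto simp: eventually_ge_at_top)
  have 2: "eventually (\<lambda>(r, c). \<bar>c * (ln r)\<^sup>2 / r\<bar> \<le> d)
             (filtercomap (\<lambda>(r, c). c * (ln r)\<^sup>2 / r) (nhds (0::real)))"
    unfolding eventually_filtercomap
  proof (intro exI conjI)
    show "eventually (\<lambda>x. \<bar>x\<bar> \<le> d) (nhds (0::real))"
      unfolding eventually_nhds_metric using d by (auto simp: dist_real_def)
  qed auto
  show ?L
    unfolding moderate_filter_def eventually_inf
    using 1 2 P by (intro exI conjI) auto
qed

text \<open>
  Directional derivatives of functions on the complex plane, regarded as a real vector space;
  the directions \<open>1\<close> and \<open>\<i>\<close> give the two partial derivatives.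
\<close>

definition dir_deriv :: "complex \<Rightarrow> (complex \<Rightarrow> real) \<Rightarrow> complex \<Rightarrow> real" where
  "dir_deriv v g z = frechet_derivative g (at z) v"

definition C1_plane :: "(complex \<Rightarrow> real) \<Rightarrow> bool" where
  "C1_plane g \<longleftrightarrow> (\<forall>z. g differentiable (at z)) \<and>
     continuous_on UNIV (dir_deriv 1 g) \<and> continuous_on UNIV (dir_deriv \<i> g)"

definition C2_plane :: "(complex \<Rightarrow> real) \<Rightarrow> bool" where
  "C2_plane g \<longleftrightarrow> C1_plane g \<and> C1_plane (dir_deriv 1 g) \<and> C1_plane (dir_deriv \<i> g)"

definition compactly_supported :: "(complex \<Rightarrow> real) \<Rightarrow> bool" where
  "compactly_supported g \<longleftrightarrow> compact (closure (support_on UNIV g))"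

definition laplacian :: "(complex \<Rightarrow> real) \<Rightarrow> complex \<Rightarrow> real" where
  "laplacian g z = dir_deriv 1 (dir_deriv 1 g) z + dir_deriv \<i> (dir_deriv \<i> g) z"

definition std_complex_gaussian :: "'a measure \<Rightarrow> ('a \<Rightarrow> complex) \<Rightarrow> bool" where
  "std_complex_gaussian M X \<longleftrightarrow>
     distributed M lborel X (\<lambda>z. ennreal (exp (- (cmod z)\<^sup>2) / pi))"

text \<open>The series converges for all \<open>z\<close> only almost surely; elsewhere the value is arbitrary.\<close>

definition random_entire :: "(nat \<Rightarrow> 'a \<Rightarrow> complex) \<Rightarrow> 'a \<Rightarrow> complex \<Rightarrow> complex" where
  "random_entire \<zeta> \<omega> z = (\<Sum>k. \<zeta> k \<omega> * z ^ k / of_real (sqrt (fact k)))"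

text \<open>
  For a nonzero entire \<open>f\<close> and compactly supported \<open>g\<close>, only finitely many terms of the sum are
  nonzero. Each zero is counted once; almost surely all zeros of \<open>random_entire\<close> are simple.
\<close>

definition centered_zero_sum ::
    "(complex \<Rightarrow> complex) \<Rightarrow> (complex \<Rightarrow> real) \<Rightarrow> real \<Rightarrow> real" where
  "centered_zero_sum f g r =
     (\<Sum>\<^sub>\<infinity>z\<in>{z. f z = 0}. g (z / of_real r)) - r\<^sup>2 / pi * (LINT z|lborel. g z)"

text \<open>
  The completion makes the choice of values on the exceptional null set irrelevant for
  measurability. The integral and \<open>ln\<close> are the total functions of the library: an infinite
  expectation, like a zero probability, has \<open>ln\<close> equal to \<open>0\<close>. This is harmless for convergence to
  a nonzero limit, which forces the expectation to be eventually finite and the probability to be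
  eventually positive; and a zero limit in the definition below occurs only for \<open>g = 0\<close>.
\<close>

definition exp_moment_limit ::
    "'a measure \<Rightarrow> (nat \<Rightarrow> 'a \<Rightarrow> complex) \<Rightarrow> real \<Rightarrow> (complex \<Rightarrow> real) \<Rightarrow> bool" where
  "exp_moment_limit M \<zeta> \<sigma> g \<longleftrightarrow>
     ((\<lambda>(r, l). 1 / (r\<^sup>2 * l\<^sup>2) *
         ln (LINT \<omega>|completion M. exp (l * r\<^sup>2 * centered_zero_sum (random_entire \<zeta> \<omega>) g r)))
       \<longlongrightarrow> \<sigma>\<^sup>2 / 2 * (LINT z|lborel. \<bar>laplacian g z\<bar>\<^sup>2)) small_lambda_filter"

end

theory Submission imports Defs begin

text \<open>
  Write \<open>V\<close> for \<open>\<sigma>\<^sup>2 \<integral>|\<Delta> h|\<^sup>2\<close>, \<open>S\<^sub>r\<close> for the centred zero sum and \<open>X\<^sub>r = r S\<^sub>r / \<surd>V\<close>, so that the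
  event in question is \<open>X\<^sub>r \<ge> c\<close>. The choice \<open>\<lambda> = u c / (r \<surd>V)\<close> turns the exponential moment of
  \<open>\<lambda> r\<^sup>2 S\<^sub>r\<close> into that of \<open>u c X\<^sub>r\<close>, and the regime \<open>c log\<^sup>2 r / r \<longlongrightarrow> 0\<close> is exactly what makes this
  \<open>\<lambda>\<close> admissible (\<open>filterlim_small_lambda_moderate\<close>). The hypothesis therefore says that, at speed
  \<open>c\<^sup>2\<close>, the variables \<open>X\<^sub>r\<close> have the logarithmic exponential moments \<open>u\<^sup>2 / 2\<close> of a standard
  Gaussian. The rest is the one-point case of the Gaertner-Ellis theorem
  (\<open>log_tail_asymptotics\<close>): the upper bound is the exponential Chebyshev inequality at
  \<open>u = 1\<close>. For the lower bound, tilt by \<open>u = 1 + d\<close>; under the tilted law \<open>X\<^sub>r / c\<close> concentrates near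
  \<open>1 + d\<close>, since the parts with \<open>X\<^sub>r < c\<close> and with \<open>X\<^sub>r > (1 + 2 d) c\<close> are exponentially
  negligible by the moments at \<open>u = 1\<close> and \<open>u = 1 + 2 d\<close>, and undoing the tilt on the remaining
  window costs a factor \<open>exp (- c\<^sup>2 (1 / 2 + O(d)))\<close>.

  The normalisation needs \<open>V > 0\<close> (\<open>integral_laplacian_squared_pos\<close>): otherwise \<open>h\<close> would be
  harmonic with compact support, hence \<open>0\<close> by the maximum principle. Measurability of \<open>S\<^sub>r\<close> with
  respect to the completed measure comes from the moment asymptotics: the Bochner integral is \<open>0\<close>
  for a function that is not integrable, and then \<open>ln 0 = 0\<close>, which is incompatible with a
  positive limit.
\<close>

section \<open>A weak maximum principle\<close>

lemma has_real_derivative_along_line: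
  fixes g :: "complex \<Rightarrow> real"
  assumes "\<And>z. g differentiable (at z)"
  shows "((\<lambda>t. g (z + t *\<^sub>R v)) has_real_derivative dir_deriv v g (z + t *\<^sub>R v)) (at t)"
proof -
  let ?D = "frechet_derivative g (at (z + t *\<^sub>R v))"
  have g: "(g has_derivative ?D) (at (z + t *\<^sub>R v))"
    using assms frechet_derivative_works by blast
  have "((\<lambda>t. g (z + t *\<^sub>R v)) has_derivative (\<lambda>s. ?D (s *\<^sub>R v))) (at t)"
    by (rule has_derivative_compose[where f = "\<lambda>t. z + t *\<^sub>R v", OF _ g])
      (auto intro!: derivative_eq_intros)
  moreover have "(\<lambda>s. ?D (s *\<^sub>R v)) = (*) (dir_deriv v g (z + t *\<^sub>R v))"
    using linear_cmul[OF has_derivative_linear[OF g]] by (auto simp: dir_deriv_def)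
  ultimately show ?thesis by (simp add: has_field_derivative_def)
qed

lemma dir_deriv_minus:
  assumes "\<And>z. g differentiable (at z)"
  shows "dir_deriv v (\<lambda>z. - g z) = (\<lambda>z. - dir_deriv v g z)"
proof
  fix z
  have "((\<lambda>z. - g z) has_derivative (\<lambda>v. - frechet_derivative g (at z) v)) (at z)"
    using assms frechet_derivative_works has_derivative_minus by blast
  from frechet_derivative_at[OF this] show "dir_deriv v (\<lambda>z. - g z) z = - dir_deriv v g z"
    unfolding dir_deriv_def by metis
qed

lemma second_derivative_nonpos_at_local_max:
  fixes f f' :: "real \<Rightarrow> real"
  assumes f: "\<And>t. (f has_real_derivative f' t) (at t)"
    and f': "(f' has_real_derivative l) (at 0)"
    and "0 < e" and max: "\<And>t. \<bar>t\<bar> < e \<Longrightarrow> f t \<le> f 0"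
  shows "l \<le> 0"
proof (rule ccontr)
  assume "\<not> l \<le> 0"
  have "f' 0 = 0"
    by (rule DERIV_local_max[OF f \<open>0 < e\<close>]) (use max in auto)
  moreover obtain d where "0 < d" and d: "\<And>s. 0 < s \<Longrightarrow> s < d \<Longrightarrow> f' 0 < f' s"
    using DERIV_pos_inc_right[OF f'] \<open>\<not> l \<le> 0\<close> by auto
  ultimately have pos: "0 < f' s" if "0 < s" "s < d" for s
    using that by metis
  \<comment> \<open>The mean value theorem on \<open>{0..t}\<close> makes \<open>f\<close> exceed its maximum.\<close>
  define t where "t = min d e / 2"
  have t: "0 < t" "t < d" "t < e"
    using \<open>0 < d\<close> \<open>0 < e\<close> by (auto simp: t_def)
  obtain s where "0 < s" "s < t" "f t - f 0 = (t - 0) * f' s"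
    using MVT2[OF t(1), of f f'] f by blast
  then have "f 0 < f t"
    using pos[of s] t by (metis diff_0_right diff_gt_0_iff_gt less_trans mult_pos_pos)
  then show False using max[of t] t by auto
qed

text \<open>
  On a disc containing the support, perturb \<open>g\<close> to \<open>g + e |z|\<^sup>2\<close>. This has strictly positive
  Laplacian, so its maximum cannot be interior, where both pure second derivatives would be
  nonpositive. On the boundary circle \<open>g\<close> vanishes and only the perturbation, of size
  \<open>e R\<^sup>2\<close>, is left; let \<open>e\<close> tend to \<open>0\<close>.
\<close>

lemma compactly_supported_subharmonic_nonpos:
  assumes "compactly_supported g"
    and diff: "\<And>z. g differentiable (at z)"
    and diff1: "\<And>z. dir_deriv 1 g differentiable (at z)"
    and diffi: "\<And>z. dir_deriv \<i> g differentiable (at z)"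
    and sub: "\<And>z. 0 \<le> laplacian g z"
  shows "g z \<le> 0"
proof -
  obtain R where "0 < R" and "closure (support_on UNIV g) \<subseteq> ball 0 R"
    using assms(1) compact_imp_bounded bounded_subset_ballD
    unfolding compactly_supported_def by blast
  then have "support_on UNIV g \<subseteq> ball 0 R"
    using closure_subset by blast
  then have zero: "g z = 0" if "R \<le> norm z" for z
    using that by (auto simp: support_on_def)
  have bound: "g z \<le> e * R\<^sup>2" if z: "z \<in> cball 0 R" and "0 < e" for z e
  proof -
    define q where "q = (\<lambda>z. g z + e * (norm z)\<^sup>2)"
    have "continuous_on (cball 0 R) g"
      using diff by (meson continuous_at_imp_continuous_on differentiable_imp_continuous_within)
    then have "continuous_on (cball 0 R) q"
      unfolding q_def by (intro continuous_intros)
    then obtain z0 where z0: "z0 \<in> cball 0 R" and max: "\<And>y. y \<in> cball 0 R \<Longrightarrow> q y \<le> q z0"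
      using continuous_attains_sup[of "cball 0 R" q] \<open>0 < R\<close> by auto
    have "norm z0 = R"
    proof (rule ccontr)
      assume "norm z0 \<noteq> R"
      then have "0 < R - norm z0"
        using z0 by auto
      have le: "dir_deriv v (dir_deriv v g) z0 + 2 * e \<le> 0"
        if v: "norm v = 1" and dv: "\<And>z. dir_deriv v g differentiable (at z)" for v
      proof (rule second_derivative_nonpos_at_local_max[OF _ _ \<open>0 < R - norm z0\<close>])
        let ?f = "\<lambda>t. q (z0 + t *\<^sub>R v)"
        let ?f' = "\<lambda>t. dir_deriv v g (z0 + t *\<^sub>R v) + e * (2 * (inner z0 v + t))"
        have nv: "inner v v = 1"
          using v by (simp add: dot_square_norm)
        have eq: "?f = (\<lambda>t. g (z0 + t *\<^sub>R v) + e * (inner z0 z0 + 2 * t * inner z0 v + t\<^sup>2))"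
          unfolding q_def power2_norm_eq_inner
          by (simp add: fun_eq_iff inner_add_left inner_add_right nv inner_commute algebra_simps power2_eq_square)
        show "(?f has_real_derivative ?f' t) (at t)" for t
          unfolding eq
          by (rule derivative_eq_intros has_real_derivative_along_line[OF diff] refl)+ simp
        show "(?f' has_real_derivative dir_deriv v (dir_deriv v g) z0 + 2 * e) (at 0)"
          using has_real_derivative_along_line[OF dv, of z0 v 0]
          by (auto intro!: derivative_eq_intros)
        show "?f t \<le> ?f 0" if "\<bar>t\<bar> < R - norm z0" for t
          using max[of "z0 + t *\<^sub>R v"] norm_triangle_ineq[of z0 "t *\<^sub>R v"] that v by simp
      qed
      show False
        using le[of 1] le[of \<i>] diff1 diffi sub[of z0] \<open>0 < e\<close> by (simp add: laplacian_def)
    qed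
    then have "q z0 = e * R\<^sup>2"
      using zero[of z0] by (simp add: q_def)
    then show ?thesis
      using max[OF z] \<open>0 < e\<close> by (simp add: q_def) (smt (verit) mult_nonneg_nonneg zero_le_power2)
  qed
  show ?thesis
  proof (cases "R \<le> norm z")
    case False
    then have "g z \<le> 0 + e" if "0 < e" for e
      using bound[of z "e / R\<^sup>2"] \<open>0 < R\<close> that by simp
    then show ?thesis by (rule field_le_epsilon)
  qed (simp add: zero)
qed

lemma compactly_supported_harmonic_zero:
  assumes "compactly_supported g" "C2_plane g" "\<And>z. laplacian g z = 0"
  shows "g = (\<lambda>_. 0)"
proof
  fix z
  have diff: "g differentiable (at z)" "dir_deriv 1 g differentiable (at z)"
    "dir_deriv \<i> g differentiable (at z)" for z
    using assms(2) by (auto simp: C2_plane_def C1_plane_def)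
  have "g z \<le> 0"
    using assms diff by (intro compactly_supported_subharmonic_nonpos) auto
  moreover have "- g z \<le> 0"
  proof (rule compactly_supported_subharmonic_nonpos[of "\<lambda>z. - g z"])
    show "compactly_supported (\<lambda>z. - g z)"
      using assms(1) by (simp add: compactly_supported_def support_on_def)
    show "0 \<le> laplacian (\<lambda>z. - g z) z" for z
      using assms(3)[of z] diff unfolding laplacian_def by (simp add: dir_deriv_minus)
  qed (use diff in \<open>auto simp: dir_deriv_minus\<close>)
  ultimately show "g z = 0" by simp
qed

lemma laplacian_zero_outside_support:
  assumes "z \<notin> closure (support_on UNIV g)"
  shows "laplacian g z = 0"
proof -
  let ?U = "- closure (support_on UNIV g)"
  have dir: "dir_deriv v f y = 0" if f: "\<And>x. x \<in> ?U \<Longrightarrow> f x = 0" and y: "y \<in> ?U" for f v y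
  proof -
    have "(f has_derivative (\<lambda>_. 0)) (at y)"
      by (rule has_derivative_transform_within_open[of "\<lambda>_. 0" _ _ _ ?U]) (use f y in auto)
    from frechet_derivative_at[OF this] show ?thesis
      unfolding dir_deriv_def by metis
  qed
  have "g x = 0" if "x \<in> ?U" for x
    using that closure_subset[of "support_on UNIV g"] by (auto simp: support_on_def)
  then show ?thesis
    using assms dir[OF dir[OF dir]] dir[OF dir] unfolding laplacian_def by simp
qed

lemma integral_laplacian_squared_pos:
  assumes "compactly_supported g" "C2_plane g" "g \<noteq> (\<lambda>_. 0)"
  shows "0 < (LINT z|lborel. \<bar>laplacian g z\<bar>\<^sup>2)"
proof -
  let ?K = "closure (support_on UNIV g)" and ?f = "\<lambda>z. \<bar>laplacian g z\<bar>\<^sup>2"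
  have cont: "continuous_on UNIV (laplacian g)"
    using assms(2) unfolding C2_plane_def C1_plane_def laplacian_def
    by (auto intro!: continuous_intros)
  then have "continuous_on ?K ?f"
    by (intro continuous_intros continuous_on_subset[OF cont]) auto
  then have "integrable lborel (\<lambda>z. indicator ?K z *\<^sub>R ?f z)"
    using assms(1) by (intro borel_integrable_compact) (auto simp: compactly_supported_def)
  moreover have "(\<lambda>z. indicator ?K z *\<^sub>R ?f z) = ?f"
    using laplacian_zero_outside_support[of _ g] by (fastforce simp: indicator_def)
  ultimately have int: "integrable lborel ?f"
    by simp
  have "integral\<^sup>L lborel ?f \<noteq> 0"
  proof
    assume "integral\<^sup>L lborel ?f = 0"
    then have "AE z in lborel. ?f z = 0"
      using integral_nonneg_eq_0_iff_AE[OF int] by simp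
    moreover have op: "open {z. laplacian g z \<noteq> 0}"
      using cont by (intro open_Collect_neq) auto
    ultimately have "{z. laplacian g z \<noteq> 0} \<in> null_sets lborel"
      by (simp add: AE_iff_null_sets)
    then have "negligible {z. laplacian g z \<noteq> 0}"
      by (simp add: negligible_iff_null_sets null_sets_completionI)
    with op have "laplacian g z = 0" for z
      using open_not_negligible by blast
    then show False
      using compactly_supported_harmonic_zero assms by blast
  qed
  moreover have "0 \<le> integral\<^sup>L lborel ?f" by simp
  ultimately show ?thesis by linarith
qed

section \<open>Gaussian tails from Gaussian exponential moments\<close>

text \<open>
  The three terms on the right dominate the exponential tilted by \<open>1 + d\<close> below the window
  \<open>c \<le> x \<le> (1 + 2 * d) * c\<close>, above it, and inside it. The tilts \<open>1\<close> and \<open>1 + 2 * d\<close> are the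
  optimal ones: they minimise the Gaussian value of the exponent of the first two terms, which
  is \<open>1 / 2 + d\<close> for both and falls short of \<open>(1 + d)\<^sup>2 / 2\<close> by \<open>d\<^sup>2 / 2\<close>.
\<close>

lemma exp_tilt_pointwise:
  fixes x c d :: real
  assumes "0 < c" "0 < d"
  shows "exp ((1 + d) * c * x)
    \<le> exp (d * c\<^sup>2) * exp (c * x)
      + exp (- (d * (1 + 2 * d) * c\<^sup>2)) * exp ((1 + 2 * d) * c * x)
      + exp ((1 + d) * (1 + 2 * d) * c\<^sup>2) * (if c \<le> x then 1 else 0)"
    (is "?L \<le> ?A + ?B + ?C")
proof -
  have nn: "0 \<le> ?A" "0 \<le> ?B" "0 \<le> ?C" by auto
  consider "x < c" | "c \<le> x" "x \<le> (1 + 2 * d) * c" | "(1 + 2 * d) * c \<le> x"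
    by linarith
  then have "?L \<le> ?A \<or> ?L \<le> ?B \<or> ?L \<le> ?C"
  proof cases
    case 1
    then have "d * c * x \<le> d * c * c"
      using assms by (intro mult_left_mono) auto
    then show ?thesis
      by (simp add: exp_add[symmetric] algebra_simps power2_eq_square)
  next
    case 2
    have "(1 + d) * c * x \<le> (1 + d) * c * ((1 + 2 * d) * c)"
      using assms 2 by (intro mult_left_mono) auto
    then show ?thesis
      using 2 by (simp add: algebra_simps power2_eq_square)
  next
    case 3
    then have "d * c * ((1 + 2 * d) * c) \<le> d * c * x"
      using assms by (intro mult_left_mono) auto
    then have "(1 + d) * c * x \<le> - (d * (1 + 2 * d) * c\<^sup>2) + (1 + 2 * d) * c * x"
      by (simp add: algebra_simps power2_eq_square)
    then have "?L \<le> ?B"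
      unfolding exp_add[symmetric] by simp
    then show ?thesis by blast
  qed
  then show ?thesis using nn by linarith
qed

text \<open>
  Integrating the pointwise bound leaves the gap \<open>d\<^sup>2 / 2\<close> between the exponents of the tilted
  moment and of its two outer parts. An error of \<open>d\<^sup>2 / 8\<close> in each logarithmic moment keeps a gap
  of \<open>d\<^sup>2 / 4\<close>, and once this amounts to a factor \<open>3\<close>, at least a third of the tilted
  moment comes from the event itself.
\<close>

lemma (in prob_space) tail_lower_bound:
  fixes c d :: real and X :: "'a \<Rightarrow> real"
  defines "\<eta> \<equiv> d\<^sup>2 / 8"
  assumes "0 < c" "0 < d"
    and [measurable]: "X \<in> borel_measurable M"
    and int: "\<And>u. u \<in> {1, 1 + d, 1 + 2 * d} \<Longrightarrow> integrable M (\<lambda>\<omega>. exp (u * c * X \<omega>))"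
    and mgf: "\<And>u. u \<in> {1, 1 + d, 1 + 2 * d} \<Longrightarrow>
      \<bar>ln (LINT \<omega>|M. exp (u * c * X \<omega>)) / c\<^sup>2 - u\<^sup>2 / 2\<bar> \<le> \<eta>"
    and pos: "\<And>u. u \<in> {1, 1 + d, 1 + 2 * d} \<Longrightarrow> 0 < (LINT \<omega>|M. exp (u * c * X \<omega>))"
    and large: "ln 3 \<le> c\<^sup>2 * (d\<^sup>2 / 4)"
  shows "exp (- (c\<^sup>2 * (1 / 2 + 2 * d + 2 * d\<^sup>2))) \<le> prob {\<omega> \<in> space M. c \<le> X \<omega>}"
proof -
  let ?E = "\<lambda>u. LINT \<omega>|M. exp (u * c * X \<omega>)"
  let ?A = "{\<omega> \<in> space M. c \<le> X \<omega>}"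
  let ?K = "exp (c\<^sup>2 * (1 / 2 + d + \<eta>))"
  have c2: "0 < c\<^sup>2" using \<open>0 < c\<close> by simp
  have upper: "?E u \<le> exp (c\<^sup>2 * (u\<^sup>2 / 2 + \<eta>))" if "u \<in> {1, 1 + d, 1 + 2 * d}" for u
  proof -
    have "ln (?E u) / c\<^sup>2 \<le> u\<^sup>2 / 2 + \<eta>" using mgf[OF that] by linarith
    then have "ln (?E u) \<le> c\<^sup>2 * (u\<^sup>2 / 2 + \<eta>)"
      using c2 by (simp add: pos_divide_le_eq mult.commute)
    then show ?thesis using pos[OF that] by (metis exp_le_cancel_iff exp_ln)
  qed
  have lower: "exp (c\<^sup>2 * ((1 + d)\<^sup>2 / 2 - \<eta>)) \<le> ?E (1 + d)"
  proof -
    have "(1 + d)\<^sup>2 / 2 - \<eta> \<le> ln (?E (1 + d)) / c\<^sup>2" using mgf[of "1 + d"] by auto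
    then have "c\<^sup>2 * ((1 + d)\<^sup>2 / 2 - \<eta>) \<le> ln (?E (1 + d))"
      using c2 by (simp add: pos_le_divide_eq mult.commute)
    then show ?thesis using pos[of "1 + d"] by (metis exp_le_cancel_iff exp_ln insertCI)
  qed
  have "?E (1 + d) \<le> (LINT \<omega>|M. exp (d * c\<^sup>2) * exp (1 * c * X \<omega>)
      + exp (- (d * (1 + 2 * d) * c\<^sup>2)) * exp ((1 + 2 * d) * c * X \<omega>)
      + exp ((1 + d) * (1 + 2 * d) * c\<^sup>2) * indicator ?A \<omega>)"
  proof (rule integral_mono)
    show "exp ((1 + d) * c * X \<omega>) \<le> exp (d * c\<^sup>2) * exp (1 * c * X \<omega>)
      + exp (- (d * (1 + 2 * d) * c\<^sup>2)) * exp ((1 + 2 * d) * c * X \<omega>)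
      + exp ((1 + d) * (1 + 2 * d) * c\<^sup>2) * indicator ?A \<omega>" if "\<omega> \<in> space M" for \<omega>
      using exp_tilt_pointwise[OF \<open>0 < c\<close> \<open>0 < d\<close>, of "X \<omega>"] that
      by (cases "c \<le> X \<omega>") simp_all
  next
    show "integrable M (\<lambda>\<omega>. exp (d * c\<^sup>2) * exp (1 * c * X \<omega>)
      + exp (- (d * (1 + 2 * d) * c\<^sup>2)) * exp ((1 + 2 * d) * c * X \<omega>)
      + exp ((1 + d) * (1 + 2 * d) * c\<^sup>2) * indicator ?A \<omega>)"
      by (intro Bochner_Integration.integrable_add integrable_mult_right int)
        (auto simp: less_top[symmetric])
  qed (use int in auto)
  also have "\<dots> = exp (d * c\<^sup>2) * ?E 1
      + exp (- (d * (1 + 2 * d) * c\<^sup>2)) * ?E (1 + 2 * d)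
      + exp ((1 + d) * (1 + 2 * d) * c\<^sup>2) * prob ?A"
    using int[of 1] int[of "1 + 2 * d"] by (simp add: less_top[symmetric])
  also have "exp (d * c\<^sup>2) * ?E 1 \<le> ?K"
  proof -
    have "exp (d * c\<^sup>2) * ?E 1 \<le> exp (d * c\<^sup>2) * exp (c\<^sup>2 * (1\<^sup>2 / 2 + \<eta>))"
      by (intro mult_left_mono upper) auto
    also have "\<dots> = ?K" by (simp add: exp_add[symmetric] algebra_simps)
    finally show ?thesis .
  qed
  also have "exp (- (d * (1 + 2 * d) * c\<^sup>2)) * ?E (1 + 2 * d) \<le> ?K"
  proof -
    have "exp (- (d * (1 + 2 * d) * c\<^sup>2)) * ?E (1 + 2 * d)
      \<le> exp (- (d * (1 + 2 * d) * c\<^sup>2)) * exp (c\<^sup>2 * ((1 + 2 * d)\<^sup>2 / 2 + \<eta>))"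
      by (intro mult_left_mono upper) auto
    also have "\<dots> = ?K"
      by (simp add: exp_add[symmetric] algebra_simps power2_eq_square)
    finally show ?thesis .
  qed
  finally have "exp (c\<^sup>2 * ((1 + d)\<^sup>2 / 2 - \<eta>))
      \<le> ?K + ?K + exp ((1 + d) * (1 + 2 * d) * c\<^sup>2) * prob ?A"
    using lower by linarith
  moreover have "3 * ?K \<le> exp (c\<^sup>2 * ((1 + d)\<^sup>2 / 2 - \<eta>))"
  proof -
    have "3 \<le> exp (c\<^sup>2 * (d\<^sup>2 / 4))"
      using large by (metis exp_le_cancel_iff exp_ln zero_less_numeral)
    then have "3 * ?K \<le> exp (c\<^sup>2 * (d\<^sup>2 / 4)) * ?K" by simp
    also have "\<dots> = exp (c\<^sup>2 * ((1 + d)\<^sup>2 / 2 - \<eta>))"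
      by (simp add: exp_add[symmetric] \<eta>_def field_simps power2_eq_square)
    finally show ?thesis .
  qed
  moreover have "exp (c\<^sup>2 * (1 / 2 + d)) \<le> ?K"
    by (simp add: \<eta>_def mult_left_mono)
  ultimately have "exp (c\<^sup>2 * (1 / 2 + d)) \<le> exp ((1 + d) * (1 + 2 * d) * c\<^sup>2) * prob ?A"
    by linarith
  then have "exp (c\<^sup>2 * (1 / 2 + d)) * exp (- ((1 + d) * (1 + 2 * d) * c\<^sup>2)) \<le> prob ?A"
    unfolding exp_minus divide_inverse[symmetric] pos_divide_le_eq[OF exp_gt_zero]
    by (simp only: mult.commute)
  moreover have "exp (c\<^sup>2 * (1 / 2 + d)) * exp (- ((1 + d) * (1 + 2 * d) * c\<^sup>2))
      = exp (- (c\<^sup>2 * (1 / 2 + 2 * d + 2 * d\<^sup>2)))"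
    by (simp add: exp_add[symmetric] field_simps power2_eq_square)
  ultimately show ?thesis by simp
qed

lemma (in prob_space) tail_upper_bound:
  fixes c :: real and X :: "'a \<Rightarrow> real"
  assumes "0 < c" and [measurable]: "X \<in> borel_measurable M"
    and int: "integrable M (\<lambda>\<omega>. exp (c * X \<omega>))"
  shows "prob {\<omega> \<in> space M. c \<le> X \<omega>} \<le> exp (- c\<^sup>2) * (LINT \<omega>|M. exp (c * X \<omega>))"
proof -
  let ?A = "{\<omega> \<in> space M. c \<le> X \<omega>}"
  have "(LINT \<omega>|M. indicator ?A \<omega>) \<le> (LINT \<omega>|M. exp (- c\<^sup>2) * exp (c * X \<omega>))"
  proof (rule integral_mono)
    show "indicator ?A \<omega> \<le> exp (- c\<^sup>2) * exp (c * X \<omega>)" for \<omega>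
      using \<open>0 < c\<close> by (auto simp: indicator_def exp_add[symmetric] power2_eq_square)
  qed (use int in \<open>auto simp: less_top[symmetric]\<close>)
  then show ?thesis using int by simp
qed

text \<open>
  Only the moments at \<open>1\<close>, \<open>1 + d\<close> and \<open>1 + 2 * d\<close> for one small \<open>d\<close> are used at each accuracy,
  so pointwise convergence in \<open>u\<close> suffices.
\<close>

theorem (in prob_space) log_tail_asymptotics:
  fixes F :: "'i filter" and c :: "'i \<Rightarrow> real" and X :: "'i \<Rightarrow> 'a \<Rightarrow> real"
  assumes c: "filterlim c at_top F"
    and mgf: "\<And>u. 0 < u \<Longrightarrow>
      ((\<lambda>i. ln (LINT \<omega>|M. exp (u * c i * X i \<omega>)) / (c i)\<^sup>2) \<longlongrightarrow> u\<^sup>2 / 2) F"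
  shows "((\<lambda>i. ln (prob {\<omega> \<in> space M. c i \<le> X i \<omega>}) / (c i)\<^sup>2) \<longlongrightarrow> - 1 / 2) F"
proof (rule tendstoI)
  fix e :: real
  assume "0 < e"
  let ?E = "\<lambda>u i. LINT \<omega>|M. exp (u * c i * X i \<omega>)"
  define d where "d = min 1 (e / 8)"
  have d: "0 < d" "d \<le> 1" "8 * d \<le> e"
    using \<open>0 < e\<close> by (auto simp: d_def)
  let ?U = "{1, 1 + d, 1 + 2 * d}"
  have Upos: "0 < u" if "u \<in> ?U" for u using that d by auto
  have c_pos: "eventually (\<lambda>i. 0 < c i) F"
    using c by (simp add: filterlim_at_top_dense)
  have "filterlim (\<lambda>i. (c i)\<^sup>2 * (d\<^sup>2 / 4)) at_top F"
    using d by (intro filterlim_at_top_mult_tendsto_pos[OF tendsto_const] filterlim_pow_at_top c) auto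
  then have c_large: "eventually (\<lambda>i. ln 3 \<le> (c i)\<^sup>2 * (d\<^sup>2 / 4)) F"
    by (simp add: filterlim_at_top)
  have close: "eventually (\<lambda>i. \<bar>ln (?E u i) / (c i)\<^sup>2 - u\<^sup>2 / 2\<bar> \<le> d\<^sup>2 / 8) F" if "u \<in> ?U" for u
    using tendstoD[OF mgf[OF Upos[OF that]], of "d\<^sup>2 / 8"] d
    by (auto simp: dist_real_def elim!: eventually_mono)
  \<comment> \<open>A vanishing integral would have logarithm \<open>0\<close>, away from the limit \<open>u\<^sup>2 / 2\<close>.\<close>
  have nz: "eventually (\<lambda>i. ?E u i \<noteq> 0) F" if "u \<in> ?U" for u
  proof -
    have "eventually (\<lambda>i. 0 < ln (?E u i) / (c i)\<^sup>2) F"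
      using Upos[OF that] by (intro order_tendstoD(1)[OF mgf]) auto
    then show ?thesis by eventually_elim auto
  qed
  have all: "eventually (\<lambda>i. \<forall>u\<in>?U. \<bar>ln (?E u i) / (c i)\<^sup>2 - u\<^sup>2 / 2\<bar> \<le> d\<^sup>2 / 8 \<and> ?E u i \<noteq> 0) F"
    using close nz by (intro eventually_ball_finite ballI eventually_conj) auto
  show "eventually (\<lambda>i. dist (ln (prob {\<omega> \<in> space M. c i \<le> X i \<omega>}) / (c i)\<^sup>2) (- 1 / 2) < e) F"
    using c_pos c_large all
  proof eventually_elim
    case (elim i)
    let ?P = "prob {\<omega> \<in> space M. c i \<le> X i \<omega>}"
    have c2: "0 < (c i)\<^sup>2" using elim(1) by simp
    \<comment> \<open>A nonzero Bochner integral certifies integrability, and with it measurability of \<open>X i\<close>.\<close>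
    have int: "integrable M (\<lambda>\<omega>. exp (u * c i * X i \<omega>))" if "u \<in> ?U" for u
      using elim(3) that not_integrable_integral_eq by blast
    have "(\<lambda>\<omega>. ln (exp (1 * c i * X i \<omega>)) / c i) \<in> borel_measurable M"
      using borel_measurable_integrable[OF int[of 1]] by measurable
    then have meas: "X i \<in> borel_measurable M"
      using elim(1) by simp
    have pos: "0 < ?E u i" if "u \<in> ?U" for u
      using elim(3) that Bochner_Integration.integral_nonneg[of M "\<lambda>\<omega>. exp (u * c i * X i \<omega>)"]
      by (metis exp_ge_zero less_eq_real_def)
    have low: "exp (- ((c i)\<^sup>2 * (1 / 2 + 2 * d + 2 * d\<^sup>2))) \<le> ?P"
      using elim by (intro tail_lower_bound d(1) meas int pos) auto
    then have Ppos: "0 < ?P"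
      by (rule less_le_trans[OF exp_gt_zero])
    have "- ((c i)\<^sup>2 * (1 / 2 + 2 * d + 2 * d\<^sup>2)) \<le> ln ?P"
      using low Ppos by (simp add: ln_ge_iff)
    then have 1: "- (1 / 2 + 2 * d + 2 * d\<^sup>2) \<le> ln ?P / (c i)\<^sup>2"
      unfolding pos_le_divide_eq[OF c2] by (simp add: algebra_simps)
    have "?P \<le> exp (- (c i)\<^sup>2) * ?E 1 i"
      using tail_upper_bound[OF elim(1) meas] int[of 1] by simp
    then have "ln ?P \<le> ln (exp (- (c i)\<^sup>2) * ?E 1 i)"
      using Ppos by simp
    also have "\<dots> = - (c i)\<^sup>2 + ln (?E 1 i)"
      using pos[of 1] by (simp add: ln_mult)
    finally have "ln ?P / (c i)\<^sup>2 \<le> - 1 + ln (?E 1 i) / (c i)\<^sup>2"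
      using c2 by (simp add: field_simps)
    also have "\<dots> \<le> - 1 + (1 / 2 + d\<^sup>2 / 8)"
    proof -
      have "\<bar>ln (?E 1 i) / (c i)\<^sup>2 - 1\<^sup>2 / 2\<bar> \<le> d\<^sup>2 / 8"
        using elim(3) by blast
      then show ?thesis
        unfolding one_power2 by linarith
    qed
    finally have 2: "ln ?P / (c i)\<^sup>2 \<le> - 1 / 2 + d\<^sup>2 / 8" by simp
    have "d\<^sup>2 \<le> d"
      using d by (simp add: power2_eq_square mult_left_le)
    then show ?case
      using 1 2 d by (auto simp: dist_real_def abs_less_iff)
  qed
qed

section \<open>Moderate deviations of the zero sums\<close>

text \<open>
  For \<open>r \<ge> e\<close> one has \<open>c / r \<le> c log\<^sup>2 r / r\<close>, so smallness of the latter also gives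
  \<open>\<lambda> \<longlongrightarrow> 0\<close>.
\<close>

lemma filterlim_small_lambda_moderate:
  fixes a :: real
  assumes "0 < a"
  shows "filterlim (\<lambda>(r, c). (r, a * c / r)) small_lambda_filter moderate_filter"
  unfolding filterlim_iff
proof (intro allI impI)
  fix P :: "real \<times> real \<Rightarrow> bool"
  assume "eventually P small_lambda_filter"
  then obtain R d where "0 < d" and P:
    "\<And>r l. R \<le> r \<Longrightarrow> l \<noteq> 0 \<Longrightarrow> \<bar>l\<bar> \<le> d \<Longrightarrow> \<bar>l\<bar> * (ln r)\<^sup>2 \<le> d \<Longrightarrow> P (r, l)"
    unfolding eventually_small_lambda_filter by blast
  have "P (r, a * c / r)"
    if r: "max R (exp 1) \<le> r" and c: "1 \<le> c" and small: "\<bar>c * (ln r)\<^sup>2 / r\<bar> \<le> d / a" for r c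
  proof (rule P)
    have "0 < r" using r exp_gt_zero[of "1::real"] by linarith
    then have "1 \<le> ln r" using r by (simp add: ln_ge_iff)
    then have ln: "1 \<le> (ln r)\<^sup>2" by simp
    show "R \<le> r" using r by simp
    show "a * c / r \<noteq> 0" using assms c \<open>0 < r\<close> by simp
    have "\<bar>a * c / r\<bar> * (ln r)\<^sup>2 = a * \<bar>c * (ln r)\<^sup>2 / r\<bar>"
      using assms by (simp add: abs_mult)
    also have "\<dots> \<le> d"
      using small assms by (simp add: pos_le_divide_eq mult.commute)
    finally show *: "\<bar>a * c / r\<bar> * (ln r)\<^sup>2 \<le> d" .
    have "\<bar>a * c / r\<bar> * 1 \<le> \<bar>a * c / r\<bar> * (ln r)\<^sup>2"
      using ln by (intro mult_left_mono) auto
    then show "\<bar>a * c / r\<bar> \<le> d" using * by linarith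
  qed
  then show "eventually (\<lambda>x. P (case x of (r, c) \<Rightarrow> (r, a * c / r))) moderate_filter"
    unfolding eventually_moderate_filter using assms \<open>0 < d\<close>
    by (intro exI[of _ "max R (exp 1)"] exI[of _ 1] exI[of _ "d / a"]) auto
qed

theorem corollary6:
  fixes M :: "'a measure" and \<zeta> :: "nat \<Rightarrow> 'a \<Rightarrow> complex"
    and \<sigma> :: real and h :: "complex \<Rightarrow> real"
  assumes "prob_space M"
    and "prob_space.indep_vars M (\<lambda>_. borel) \<zeta> UNIV"
    and "\<And>k. std_complex_gaussian M (\<zeta> k)"
    and "\<sigma> > 0"
    and "\<And>g. compactly_supported g \<Longrightarrow> C2_plane g \<Longrightarrow> exp_moment_limit M \<zeta> \<sigma> g"
    and "compactly_supported h" and "C2_plane h" and "h \<noteq> (\<lambda>_. 0)"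
  shows "((\<lambda>(r, c). 1 / c\<^sup>2 *
            ln (measure (completion M)
              {\<omega> \<in> space M. centered_zero_sum (random_entire \<zeta> \<omega>) h r
                 \<ge> c * \<sigma> / r * sqrt (LINT z|lborel. \<bar>laplacian h z\<bar>\<^sup>2)}))
          \<longlongrightarrow> - 1 / 2) moderate_filter"
proof -
  let ?N = "completion M"
  define v where "v = \<sigma> * sqrt (LINT z|lborel. \<bar>laplacian h z\<bar>\<^sup>2)"
  define S where "S = (\<lambda>r \<omega>. centered_zero_sum (random_entire \<zeta> \<omega>) h r)"
  have D: "0 < (LINT z|lborel. \<bar>laplacian h z\<bar>\<^sup>2)"
    using assms by (intro integral_laplacian_squared_pos)
  have v: "0 < v" using D \<open>\<sigma> > 0\<close> by (simp add: v_def)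
  have v2: "\<sigma>\<^sup>2 / 2 * (LINT z|lborel. \<bar>laplacian h z\<bar>\<^sup>2) = v\<^sup>2 / 2"
    using D by (simp add: v_def power_mult_distrib)
  interpret N: prob_space ?N
    using assms(1) by (rule prob_space.prob_space_completion)
  have ev_pos: "eventually (\<lambda>(r, c). 0 < r \<and> 0 < c) moderate_filter"
    unfolding eventually_moderate_filter
    by (intro exI[of _ 1]) auto
  have "exp_moment_limit M \<zeta> \<sigma> h"
    using assms by blast
  then have lim: "((\<lambda>(r, l). 1 / (r\<^sup>2 * l\<^sup>2) * ln (LINT \<omega>|?N. exp (l * r\<^sup>2 * S r \<omega>)))
      \<longlongrightarrow> v\<^sup>2 / 2) small_lambda_filter"
    unfolding exp_moment_limit_def v2 S_def .
  have mgf: "((\<lambda>i. ln (LINT \<omega>|?N. exp (u * snd i * (fst i * S (fst i) \<omega> / v))) / (snd i)\<^sup>2)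
      \<longlongrightarrow> u\<^sup>2 / 2) moderate_filter" if "0 < u" for u
  proof -
    have "((\<lambda>x. (u / v)\<^sup>2 * (case (case x of (r, c) \<Rightarrow> (r, u / v * c / r)) of
        (r, l) \<Rightarrow> 1 / (r\<^sup>2 * l\<^sup>2) * ln (LINT \<omega>|?N. exp (l * r\<^sup>2 * S r \<omega>))))
      \<longlongrightarrow> (u / v)\<^sup>2 * (v\<^sup>2 / 2)) moderate_filter"
      using v that
      by (intro tendsto_mult tendsto_const filterlim_compose[OF lim] filterlim_small_lambda_moderate) simp
    then have "((\<lambda>x. (u / v)\<^sup>2 * (case (case x of (r, c) \<Rightarrow> (r, u / v * c / r)) of
        (r, l) \<Rightarrow> 1 / (r\<^sup>2 * l\<^sup>2) * ln (LINT \<omega>|?N. exp (l * r\<^sup>2 * S r \<omega>))))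
      \<longlongrightarrow> u\<^sup>2 / 2) moderate_filter"
      using v by (simp add: power_divide)
    moreover have "eventually (\<lambda>x. (u / v)\<^sup>2 * (case (case x of (r, c) \<Rightarrow> (r, u / v * c / r)) of
        (r, l) \<Rightarrow> 1 / (r\<^sup>2 * l\<^sup>2) * ln (LINT \<omega>|?N. exp (l * r\<^sup>2 * S r \<omega>)))
      = ln (LINT \<omega>|?N. exp (u * snd x * (fst x * S (fst x) \<omega> / v))) / (snd x)\<^sup>2) moderate_filter"
      using ev_pos
    proof eventually_elim
      case (elim x)
      obtain r c where x: "x = (r, c)" by (cases x)
      then have "0 < r" "0 < c" using elim by auto
      have "u / v * c / r * r\<^sup>2 * S r \<omega> = u * c * (r * S r \<omega> / v)" for \<omega>
        using \<open>0 < r\<close> by (simp add: power2_eq_square)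
      moreover have "(u / v)\<^sup>2 * (1 / (r\<^sup>2 * (u / v * c / r)\<^sup>2)) = 1 / c\<^sup>2"
        using \<open>0 < r\<close> \<open>0 < c\<close> v that by (simp add: field_simps)
      ultimately show ?case
        unfolding x by (simp del: times_divide_eq_left times_divide_eq_right add: mult.assoc[symmetric])
        (simp add: divide_inverse mult.commute)
    qed
    ultimately show ?thesis by (rule Lim_transform_eventually)
  qed
  have "filterlim snd at_top moderate_filter"
    unfolding filterlim_at_top eventually_moderate_filter by (metis snd_conv zero_less_one)
  from N.log_tail_asymptotics[OF this mgf]
  have "((\<lambda>i. ln (measure ?N {\<omega> \<in> space ?N. snd i \<le> fst i * S (fst i) \<omega> / v}) / (snd i)\<^sup>2)
      \<longlongrightarrow> - 1 / 2) moderate_filter" .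
  moreover have "eventually (\<lambda>i.
      ln (measure ?N {\<omega> \<in> space ?N. snd i \<le> fst i * S (fst i) \<omega> / v}) / (snd i)\<^sup>2 =
      (case i of (r, c) \<Rightarrow> 1 / c\<^sup>2 * ln (measure ?N
        {\<omega> \<in> space M. S r \<omega> \<ge> c * \<sigma> / r * sqrt (LINT z|lborel. \<bar>laplacian h z\<bar>\<^sup>2)})))
      moderate_filter"
    using ev_pos
  proof eventually_elim
    case (elim i)
    obtain r c where i: "i = (r, c)" by (cases i)
    then have "0 < r" using elim by auto
    have "c * \<sigma> / r * sqrt (LINT z|lborel. \<bar>laplacian h z\<bar>\<^sup>2) = c * v / r"
      unfolding v_def by simp
    moreover have "c \<le> r * x / v \<longleftrightarrow> c * v / r \<le> x" for x
      using \<open>0 < r\<close> v by (simp add: pos_le_divide_eq pos_divide_le_eq mult.commute)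
    ultimately have "c \<le> r * S r \<omega> / v \<longleftrightarrow> c * \<sigma> / r * sqrt (LINT z|lborel. \<bar>laplacian h z\<bar>\<^sup>2) \<le> S r \<omega>" for \<omega>
      by metis
    then show ?case
      unfolding i by simp
  qed
  ultimately show ?thesis
    unfolding S_def by (rule Lim_transform_eventually)
qed

end
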